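(* Thomas division and Janet division on the set $\mathbb{M}$ of monomials in $x_1,\dots,x_n$ are noetherian: for $L$ equal to either of these divisions, every finite set $U\subset\mathbb{M}$ is finitely generated with respect to $L$, i.e. there is a finite $L$-involutive set $\tilde U\subset\mathbb{M}$ with $U\subseteq\tilde U$ and $C(\tilde U)=C(U)$.
   Context: $K$ is a field of characteristic zero, $\mathbb{M}$ is the monoid of monomials in $K[x_1,\dots,x_n]$, and $\deg_i(u)$ is the degree of $x_i$ in $u$. For the divisions $L$ below, each finite $U\subset\mathbb{M}$ and $u\in U$ determine a set of multiplicative variables, and $L(u,U)$ denotes the set of all monomials in the multiplicative variables of $u$. Thomas division: for finite $U$ let $h_i(U)=\max\{\deg_i(u)\mid u\in U\}$. The variable $x_i$ is multiplicative for $u\in U$ if $\deg_i(u)=h_i(U)$ and non-multiplicative otherwise. Janet division: for finite $U$, $1\le i\le n$ and non-negative integers $d_1,\dots,d_i$ let $[d_1,\dots,d_i]=\{u\in U\mid \deg_j(u)=d_j,\ 1\le j\le i\}$. The variable $x_i$ is multiplicative for $u\in U$ if $i=1$ and $\deg_1(u)=\max\{\deg_1(v)\mid v\in U\}$, or if $i>1$, $u\in[d_1,\dots,d_{i-1}]$ and $\deg_i(u)=\max\{\deg_i(v)\mid v\in[d_1,\dots,d_{i-1}]\}$; otherwise it is non-multiplicative. The cone of $U$ is $C(U)=\bigcup_{u\in U}u\,\mathbb{M}$ and its involutive cone is $C_L(U)=\bigcup_{u\in U}u\,L(u,U)$. A set $U$ is $L$-involutive if $C(U)=C_L(U)$. 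*)

theory Defs
  imports "HOL-Library.Poly_Mapping"
begin

text \<open>Polynomials over \<open>'k\<close> in variables indexed by natural numbers, with the convolution product of
  \<^theory>\<open>HOL-Library.Poly_Mapping\<close>: a finitely supported exponent function \<open>m\<close> carries the
  coefficient of the product of the \<open>x\<^sub>i ^ lookup m i\<close>.\<close>

type_synonym 'k mpolynomial = "(nat \<Rightarrow>\<^sub>0 nat) \<Rightarrow>\<^sub>0 'k"

text \<open>The monomials in the variables \<open>x\<^sub>i\<close> with \<open>i \<in> X\<close>, as elements of the polynomial ring.\<close>

definition monomials_in :: "nat set \<Rightarrow> 'k::field_char_0 mpolynomial set" where
  "monomials_in X = {Poly_Mapping.single m 1 | m. Poly_Mapping.keys m \<subseteq> X}"

abbreviation monomials :: "nat \<Rightarrow> 'k::field_char_0 mpolynomial set" where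
  "monomials n \<equiv> monomials_in {1..n}"

text \<open>The element 0 is inserted only to give the zero polynomial the degree 0.\<close>

definition deg_in :: "nat \<Rightarrow> 'k::field_char_0 mpolynomial \<Rightarrow> nat" where
  "deg_in i u = Max (insert 0 ((\<lambda>m. Poly_Mapping.lookup m i) ` Poly_Mapping.keys u))"

text \<open>A division is given by its multiplicative variables: \<open>D U u\<close> is the set of indices of the
  variables that are multiplicative for \<open>u \<in> U\<close>.\<close>

type_synonym 'k division = "'k mpolynomial set \<Rightarrow> 'k mpolynomial \<Rightarrow> nat set"

definition thomas :: "nat \<Rightarrow> 'k::field_char_0 division" where
  "thomas n U u = {i \<in> {1..n}. deg_in i u = Max (deg_in i ` U)}"

text \<open>\<open>janet_class U d i\<close> is \<open>[d 1, \<dots>, d i]\<close>; the values of \<open>d\<close> outside \<open>{1..i}\<close> are irrelevant.\<close>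

definition janet_class ::
    "'k::field_char_0 mpolynomial set \<Rightarrow> (nat \<Rightarrow> nat) \<Rightarrow> nat \<Rightarrow> 'k mpolynomial set" where
  "janet_class U d i = {u \<in> U. \<forall>j\<in>{1..i}. deg_in j u = d j}"

definition janet :: "nat \<Rightarrow> 'k::field_char_0 division" where
  "janet n U u = {i \<in> {1..n}.
     i = 1 \<and> deg_in 1 u = Max (deg_in 1 ` U) \<or>
     i > 1 \<and> (\<exists>d. u \<in> janet_class U d (i - 1) \<and>
                   deg_in i u = Max (deg_in i ` janet_class U d (i - 1)))}"

definition cone :: "nat \<Rightarrow> 'k::field_char_0 mpolynomial set \<Rightarrow> 'k mpolynomial set" where
  "cone n U = (\<Union>u\<in>U. (*) u ` monomials n)"

definition involutive_cone ::
    "'k::field_char_0 division \<Rightarrow> 'k mpolynomial set \<Rightarrow> 'k mpolynomial set" where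
  "involutive_cone D U = (\<Union>u\<in>U. (*) u ` monomials_in (D U u))"

definition involutive ::
    "nat \<Rightarrow> 'k::field_char_0 division \<Rightarrow> 'k mpolynomial set \<Rightarrow> bool" where
  "involutive n D U \<longleftrightarrow> cone n U = involutive_cone D U"

definition finitely_generated ::
    "nat \<Rightarrow> 'k::field_char_0 division \<Rightarrow> 'k mpolynomial set \<Rightarrow> bool" where
  "finitely_generated n D U \<longleftrightarrow>
     (\<exists>V. finite V \<and> V \<subseteq> monomials n \<and> involutive n D V \<and> U \<subseteq> V \<and> cone n V = cone n U)"

definition noetherian_division :: "nat \<Rightarrow> 'k::field_char_0 division \<Rightarrow> bool" where
  "noetherian_division n D \<longleftrightarrow>
     (\<forall>U. finite U \<and> U \<subseteq> monomials n \<longrightarrow> finitely_generated n D U)"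

end

theory Submission
  imports Defs
begin

text \<open>
  Write \<open>h\<^sub>i\<close> for the largest degree in \<open>x\<^sub>i\<close> occurring in a finite set \<open>U\<close> of monomials.  One and the
  same completion serves both divisions: the set \<open>V\<close> of all monomials of the cone of \<open>U\<close> whose
  degree in each \<open>x\<^sub>i\<close> is at most \<open>h\<^sub>i\<close>.  It is finite, contains \<open>U\<close>, and generates the same cone.

  To see that \<open>V\<close> is involutive for the Thomas division, truncate a monomial \<open>w\<close> of the cone by
  lowering each exponent \<open>w\<^sub>i\<close> to \<open>min w\<^sub>i h\<^sub>i\<close>.  An element of \<open>U\<close> dividing \<open>w\<close> has exponents at most
  \<open>h\<^sub>i\<close>, so it divides the truncation \<open>v\<close> as well, and \<open>v\<close> lies in \<open>V\<close>.  The quotient of \<open>w\<close> by \<open>v\<close>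
  involves only variables whose exponent was actually lowered; for these \<open>v\<close> has the maximal
  degree \<open>h\<^sub>i\<close>, so they are multiplicative for \<open>v\<close> (lemma \<open>thomas_involutive_truncated_cone\<close>).

  The Janet division compares degrees only within a class \<open>[d\<^sub>1, \<dots>, d\<^sub>i\<^sub>-\<^sub>1]\<close>, hence a degree
  that is maximal in the whole set is maximal there, and every Thomas multiplicative variable is
  Janet multiplicative.  More multiplicative variables can only enlarge the involutive cone, which
  stays inside the cone; so a finite set that is involutive for Thomas is so for Janet.
\<close>

section \<open>Exponents of monomials\<close>

lemma monomials_inE:
  assumes "u \<in> monomials_in X"
  obtains a where "u = Poly_Mapping.single a 1" "Poly_Mapping.keys a \<subseteq> X"
  using assms by (auto simp: monomials_in_def)

lemma single_in_monomials_in_iff [simp]: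
  "Poly_Mapping.single a (1::'k::field_char_0) \<in> monomials_in X \<longleftrightarrow> Poly_Mapping.keys a \<subseteq> X"
proof -
  have "Poly_Mapping.single a (1::'k) = Poly_Mapping.single b 1 \<longleftrightarrow> a = b"
    for a b :: "nat \<Rightarrow>\<^sub>0 nat"
    by (metis keys_single singleton_inject zero_neq_one)
  then show ?thesis by (auto simp: monomials_in_def)
qed

lemma monomials_in_mono: "X \<subseteq> Y \<Longrightarrow> monomials_in X \<subseteq> monomials_in Y"
  by (auto simp: monomials_in_def)

lemma deg_in_single [simp]:
  "deg_in i (Poly_Mapping.single a (1::'k::field_char_0)) = Poly_Mapping.lookup a i"
  by (simp add: deg_in_def)

lemma finite_bounded_monomials:
  fixes h :: "nat \<Rightarrow> nat"
  assumes "finite X"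
  shows "finite {u \<in> (monomials_in X :: 'k::field_char_0 mpolynomial set). \<forall>i\<in>X. deg_in i u \<le> h i}"
    (is "finite ?B")
proof -
  let ?E = "{a. Poly_Mapping.keys a \<subseteq> X \<and> (\<forall>i\<in>X. Poly_Mapping.lookup a i \<le> h i)}"
  let ?F = "{f. \<forall>i. (i \<in> X \<longrightarrow> f i \<in> {..Max (h ` X)}) \<and> (i \<notin> X \<longrightarrow> f i = (0::nat))}"
  have "Poly_Mapping.lookup ` ?E \<subseteq> ?F"
  proof (clarsimp, intro conjI impI)
    fix a :: "nat \<Rightarrow>\<^sub>0 nat" and i
    assume a: "Poly_Mapping.keys a \<subseteq> X" "\<forall>i\<in>X. Poly_Mapping.lookup a i \<le> h i"
    show "Poly_Mapping.lookup a i \<le> Max (h ` X)" if "i \<in> X"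
      using a(2) that assms by (meson Max_ge finite_imageI image_eqI order_trans)
    show "Poly_Mapping.lookup a i = 0" if "i \<notin> X"
      using a(1) that by (auto simp: in_keys_iff)
  qed
  moreover have "finite ?F"
    by (rule finite_set_of_finite_funs) (use assms in auto)
  ultimately have "finite (Poly_Mapping.lookup ` ?E)"
    by (rule finite_subset)
  then have "finite ?E"
    by (rule finite_imageD) (auto intro: inj_onI poly_mapping_eqI)
  moreover have "?B \<subseteq> (\<lambda>a. Poly_Mapping.single a 1) ` ?E"
    by (auto elim!: monomials_inE)
  ultimately show ?thesis
    by (meson finite_imageI finite_subset)
qed

section \<open>Cones\<close>

lemma mult_in_cone: "u \<in> U \<Longrightarrow> t \<in> monomials n \<Longrightarrow> u * t \<in> cone n U"
  by (auto simp: cone_def)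

lemma mult_in_involutive_cone:
  "u \<in> U \<Longrightarrow> t \<in> monomials_in (D U u) \<Longrightarrow> u * t \<in> involutive_cone D U"
  by (auto simp: involutive_cone_def)

lemma single_in_cone_iff:
  fixes U :: "'k::field_char_0 mpolynomial set"
  assumes "U \<subseteq> monomials n" "Poly_Mapping.keys w \<subseteq> {1..n}"
  shows "Poly_Mapping.single w 1 \<in> cone n U \<longleftrightarrow>
         (\<exists>u\<in>U. \<forall>i. deg_in i u \<le> Poly_Mapping.lookup w i)"
proof
  assume "Poly_Mapping.single w 1 \<in> cone n U"
  then obtain u t where u: "u \<in> U" and t: "t \<in> monomials n"
    and w: "Poly_Mapping.single w 1 = u * t"
    by (auto simp: cone_def)
  obtain a where a: "u = Poly_Mapping.single a 1"
    using u assms(1) by (auto elim: monomials_inE)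
  obtain b where b: "t = Poly_Mapping.single b 1"
    using t by (auto elim: monomials_inE)
  have "deg_in i (Poly_Mapping.single w (1::'k)) = deg_in i u + deg_in i t" for i
    unfolding w by (simp add: a b mult_single lookup_add)
  then show "\<exists>u\<in>U. \<forall>i. deg_in i u \<le> Poly_Mapping.lookup w i"
    using u by (auto intro!: bexI[of _ u])
next
  assume "\<exists>u\<in>U. \<forall>i. deg_in i u \<le> Poly_Mapping.lookup w i"
  then obtain u where u: "u \<in> U" and le: "\<And>i. deg_in i u \<le> Poly_Mapping.lookup w i"
    by blast
  obtain a where a: "u = Poly_Mapping.single a 1"
    using u assms(1) by (auto elim: monomials_inE)
  have "a + (w - a) = w"
    using le by (intro poly_mapping_eqI) (simp add: a lookup_add lookup_minus)
  have "Poly_Mapping.keys (w - a) \<subseteq> {1..n}"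
    using assms(2) by (auto simp: in_keys_iff lookup_minus)
  moreover from \<open>a + (w - a) = w\<close>
  have "Poly_Mapping.single w 1 = u * Poly_Mapping.single (w - a) 1"
    by (simp add: a mult_single)
  ultimately show "Poly_Mapping.single w 1 \<in> cone n U"
    using u by (metis mult_in_cone single_in_monomials_in_iff)
qed

lemma subset_cone: "U \<subseteq> cone n U"
proof
  fix u assume "u \<in> U"
  moreover have "1 \<in> monomials n"
    using single_in_monomials_in_iff[of 0] by simp
  ultimately show "u \<in> cone n U"
    by (metis mult_in_cone mult.right_neutral)
qed

lemma cone_mono: "U \<subseteq> V \<Longrightarrow> cone n U \<subseteq> cone n V"
  by (auto simp: cone_def)

lemma cone_subset_monomials:
  assumes "U \<subseteq> monomials n"
  shows "cone n U \<subseteq> monomials n"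
proof
  fix x assume "x \<in> cone n U"
  then obtain u t where "u \<in> U" "t \<in> monomials n" and x: "x = u * t"
    by (auto simp: cone_def)
  with assms have "u \<in> monomials n" by blast
  then obtain a where a: "u = Poly_Mapping.single a 1" "Poly_Mapping.keys a \<subseteq> {1..n}"
    by (rule monomials_inE)
  obtain b where b: "t = Poly_Mapping.single b 1" "Poly_Mapping.keys b \<subseteq> {1..n}"
    using \<open>t \<in> monomials n\<close> by (rule monomials_inE)
  have "Poly_Mapping.keys (a + b) \<subseteq> {1..n}"
    using a(2) b(2) keys_add[of a b] by blast
  then show "x \<in> monomials n"
    by (simp add: x a(1) b(1) mult_single)
qed

lemma involutive_cone_subset_cone:
  assumes "\<And>u. u \<in> U \<Longrightarrow> D U u \<subseteq> {1..n}"
  shows "involutive_cone D U \<subseteq> cone n U"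
  unfolding involutive_cone_def cone_def
  by (intro UN_mono image_mono monomials_in_mono assms order_refl)

section \<open>Comparison of the two divisions\<close>

lemma involutive_if_more_multiplicative:
  assumes "involutive n D U"
    and "\<And>u. u \<in> U \<Longrightarrow> D U u \<subseteq> E U u" "\<And>u. u \<in> U \<Longrightarrow> E U u \<subseteq> {1..n}"
  shows "involutive n E U"
proof -
  have "involutive_cone D U \<subseteq> involutive_cone E U"
    unfolding involutive_cone_def
    by (intro UN_mono image_mono monomials_in_mono assms(2) order_refl)
  then show ?thesis
    using assms(1) involutive_cone_subset_cone[of U E n, OF assms(3)]
    unfolding involutive_def by blast
qed

lemma thomas_subset_janet:
  assumes "finite U" "u \<in> U"
  shows "thomas n U u \<subseteq> janet n U u"
proof
  fix i assume "i \<in> thomas n U u"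
  then have i: "i \<in> {1..n}" and max: "deg_in i u = Max (deg_in i ` U)"
    by (auto simp: thomas_def)
  show "i \<in> janet n U u"
  proof (cases "i = 1")
    case True
    with i max show ?thesis by (simp add: janet_def)
  next
    case False
    \<comment> \<open>The degrees of \<open>u\<close> itself select the class that contains \<open>u\<close>.\<close>
    let ?C = "janet_class U (\<lambda>j. deg_in j u) (i - 1)"
    have u: "u \<in> ?C" and "?C \<subseteq> U"
      using assms by (auto simp: janet_class_def)
    have "Max (deg_in i ` ?C) = deg_in i u"
    proof (rule Max_eqI)
      show "finite (deg_in i ` ?C)"
        using \<open>?C \<subseteq> U\<close> assms(1) finite_subset by blast
      show "d \<le> deg_in i u" if "d \<in> deg_in i ` ?C" for d
        using that \<open>?C \<subseteq> U\<close> assms(1) unfolding max by (auto intro: Max_ge)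
      show "deg_in i u \<in> deg_in i ` ?C"
        using u by (rule imageI)
    qed
    with u i False show ?thesis
      unfolding janet_def by force
  qed
qed

section \<open>Completion by the truncated cone\<close>

definition truncated_cone ::
    "nat \<Rightarrow> 'k::field_char_0 mpolynomial set \<Rightarrow> 'k mpolynomial set" where
  "truncated_cone n U = {v \<in> cone n U. \<forall>i\<in>{1..n}. deg_in i v \<le> Max (deg_in i ` U)}"

lemma truncated_cone_subset_monomials:
  "U \<subseteq> monomials n \<Longrightarrow> truncated_cone n U \<subseteq> monomials n"
  using cone_subset_monomials by (auto simp: truncated_cone_def)

lemma finite_truncated_cone:
  assumes "U \<subseteq> monomials n"
  shows "finite (truncated_cone n U)"
  by (rule finite_subset[OF _ finite_bounded_monomials[of "{1..n}" "\<lambda>i. Max (deg_in i ` U)"]])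
    (use truncated_cone_subset_monomials[OF assms] in \<open>auto simp: truncated_cone_def\<close>)

lemma subset_truncated_cone: "finite U \<Longrightarrow> U \<subseteq> truncated_cone n U"
  using subset_cone by (auto simp: truncated_cone_def)

text \<open>Divide a monomial of the cone by its truncation: the truncation stays in the cone, since the
  exponents of the elements of \<open>U\<close> are within the bounds, and the quotient involves only variables
  in which the truncation has maximal degree.\<close>

lemma cone_subset_thomas_cone_of_truncated_cone:
  fixes U :: "'k::field_char_0 mpolynomial set"
  assumes "finite U" "U \<subseteq> monomials n"
  shows "cone n U \<subseteq> involutive_cone (thomas n) (truncated_cone n U)"
proof
  fix x assume x: "x \<in> cone n U"
  then have "x \<in> monomials n"
    using cone_subset_monomials[OF assms(2)] by blast
  then obtain w where w: "x = Poly_Mapping.single w 1" and kw: "Poly_Mapping.keys w \<subseteq> {1..n}"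
    by (rule monomials_inE)
  define h where "h i = Max (deg_in i ` U)" for i
  define v where "v = Poly_Mapping.mapp (\<lambda>i e. min e (h i)) w"
  have lookup_v: "Poly_Mapping.lookup v i = min (Poly_Mapping.lookup w i) (h i)" for i
    by (simp add: v_def lookup_mapp when_def in_keys_iff)
  have kv: "Poly_Mapping.keys v \<subseteq> {1..n}"
    using kw by (auto simp: in_keys_iff lookup_v)
  obtain u where u: "u \<in> U" and le: "\<And>i. deg_in i u \<le> Poly_Mapping.lookup w i"
    using x single_in_cone_iff[OF assms(2) kw] by (auto simp: w)
  have "deg_in i u \<le> h i" for i
    using u assms(1) by (simp add: h_def)
  with le u have "Poly_Mapping.single v 1 \<in> cone n U"
    using single_in_cone_iff[OF assms(2) kv] by (auto simp: lookup_v)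
  then have v: "Poly_Mapping.single v 1 \<in> truncated_cone n U"
    by (simp add: truncated_cone_def lookup_v h_def)
  have "Poly_Mapping.keys (w - v) \<subseteq>
      thomas n (truncated_cone n U) (Poly_Mapping.single v 1)"
  proof
    fix i assume "i \<in> Poly_Mapping.keys (w - v)"
    then have "Poly_Mapping.lookup w i > Poly_Mapping.lookup v i"
      by (simp add: in_keys_iff lookup_minus)
    then have "i \<in> Poly_Mapping.keys w" and "Poly_Mapping.lookup v i = h i"
      by (auto simp: in_keys_iff lookup_v)
    with kw have "i \<in> {1..n}" by blast
    have "Max (deg_in i ` truncated_cone n U) = h i"
    proof (rule Max_eqI)
      show "finite (deg_in i ` truncated_cone n U)"
        using finite_truncated_cone[OF assms(2)] by blast
      show "d \<le> h i" if "d \<in> deg_in i ` truncated_cone n U" for d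
        using that \<open>i \<in> {1..n}\<close> unfolding truncated_cone_def h_def by blast
      show "h i \<in> deg_in i ` truncated_cone n U"
        using v \<open>Poly_Mapping.lookup v i = h i\<close> by (metis deg_in_single image_eqI)
    qed
    then show "i \<in> thomas n (truncated_cone n U) (Poly_Mapping.single v 1)"
      using \<open>i \<in> {1..n}\<close> \<open>Poly_Mapping.lookup v i = h i\<close> by (simp add: thomas_def)
  qed
  moreover have "v + (w - v) = w"
    by (intro poly_mapping_eqI) (simp add: lookup_add lookup_minus lookup_v)
  then have "x = Poly_Mapping.single v 1 * Poly_Mapping.single (w - v) 1"
    by (simp add: w mult_single)
  ultimately show "x \<in> involutive_cone (thomas n) (truncated_cone n U)"
    using v by (simp add: mult_in_involutive_cone)
qed

text \<open>The cone of a subset of \<open>cone n U\<close> stays in \<open>cone n U\<close> because divisibility is transitive.\<close>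

lemma cone_truncated_cone:
  fixes U :: "'k::field_char_0 mpolynomial set"
  assumes "finite U" "U \<subseteq> monomials n"
  shows "cone n (truncated_cone n U) = cone n U"
proof
  have V: "truncated_cone n U \<subseteq> monomials n"
    by (rule truncated_cone_subset_monomials[OF assms(2)])
  show "cone n (truncated_cone n U) \<subseteq> cone n U"
  proof
    fix x assume x: "x \<in> cone n (truncated_cone n U)"
    then have "x \<in> monomials n"
      using cone_subset_monomials[OF V] by blast
    then obtain w where w: "x = Poly_Mapping.single w 1" and kw: "Poly_Mapping.keys w \<subseteq> {1..n}"
      by (rule monomials_inE)
    obtain y where y: "y \<in> truncated_cone n U"
        and yw: "\<And>i. deg_in i y \<le> Poly_Mapping.lookup w i"
      using x single_in_cone_iff[OF V kw] by (auto simp: w)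
    have "y \<in> monomials n"
      using V y by blast
    then obtain v where v: "y = Poly_Mapping.single v 1" and kv: "Poly_Mapping.keys v \<subseteq> {1..n}"
      by (rule monomials_inE)
    obtain u where "u \<in> U" and "\<And>i. deg_in i u \<le> Poly_Mapping.lookup v i"
      using y single_in_cone_iff[OF assms(2) kv] by (auto simp: truncated_cone_def v)
    with yw show "x \<in> cone n U"
      unfolding w single_in_cone_iff[OF assms(2) kw] by (metis deg_in_single order_trans v)
  qed
  show "cone n U \<subseteq> cone n (truncated_cone n U)"
    by (intro cone_mono subset_truncated_cone assms(1))
qed

lemma thomas_involutive_truncated_cone:
  assumes "finite U" "U \<subseteq> monomials n"
  shows "involutive n (thomas n) (truncated_cone n U)"
proof -
  have "involutive_cone (thomas n) (truncated_cone n U) \<subseteq> cone n (truncated_cone n U)"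
    by (rule involutive_cone_subset_cone) (auto simp: thomas_def)
  then show ?thesis
    using cone_subset_thomas_cone_of_truncated_cone[OF assms] cone_truncated_cone[OF assms]
    by (auto simp: involutive_def)
qed

theorem proposition4p5:
  fixes n :: nat
  shows "noetherian_division n (thomas n :: 'k::field_char_0 division) \<and>
         noetherian_division n (janet n :: 'k::field_char_0 division)"
proof -
  have "finitely_generated n (thomas n) U \<and> finitely_generated n (janet n) U"
    if U: "finite U" "U \<subseteq> monomials n" for U :: "'k mpolynomial set"
  proof -
    let ?V = "truncated_cone n U"
    have V: "finite ?V" "?V \<subseteq> monomials n" "U \<subseteq> ?V" "cone n ?V = cone n U"
      by (rule finite_truncated_cone[OF U(2)] truncated_cone_subset_monomials[OF U(2)]
          subset_truncated_cone[OF U(1)] cone_truncated_cone[OF U])+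
    have thomas: "involutive n (thomas n) ?V"
      by (rule thomas_involutive_truncated_cone[OF U])
    then have "involutive n (janet n) ?V"
      by (rule involutive_if_more_multiplicative)
        (rule thomas_subset_janet[OF V(1)], assumption, auto simp: janet_def)
    with thomas V show ?thesis
      unfolding finitely_generated_def by blast
  qed
  then show ?thesis
    by (simp add: noetherian_division_def)
qed

end
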